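(* Let $n\ge 1$ and let $\lambda,\mu$ be two integer partitions of $n$. Then the following four sets have equal cardinality: (1) the set of $\pi\in\mathfrak{S}_n(132)$ whose IRD and LDE length distributions are respectively $\lambda$ and $\mu$; (2) the set of $\pi\in\mathfrak{S}_n(132)$ whose IRD and LDE length distributions are respectively $\mu$ and $\lambda$; (3) the set of $\pi\in\mathfrak{S}_n(132)$ whose v-CIS and DRD length distributions are respectively $\lambda$ and $\mu$; (4) the set of $\pi\in\mathfrak{S}_n(132)$ whose v-CIS and DRD length distributions are respectively $\mu$ and $\lambda$.
   Context: $\mathfrak{S}_n(132)$ is the set of permutations $\pi=\pi_1\cdots\pi_n$ of $[n]=\{1,\dots,n\}$ avoiding the pattern $132$ (no $i<j<k$ with $\pi_i<\pi_k<\pi_j$). Each of the following decompositions partitions the entries of $\pi$ into subsequences; its length distribution is the integer partition of $n$ formed by the lengths of these subsequences. IRD: decomposition of $\pi$ into its increasing runs, i.e. maximal subsequences $\pi_i\pi_{i+1}\cdots\pi_{i+k-1}$ of consecutive positions with $\pi_i<\pi_{i+1}<\cdots<\pi_{i+k-1}$. DRD: decomposition of $\pi$ into its decreasing runs, defined analogously with $>$ in place of $<$. v-CIS: decomposition of $\pi$ into its maximal value-consecutive increasing subsequences, i.e. maximal subsequences $\pi_{i_1}\pi_{i_2}\cdots\pi_{i_k}$ with $i_1<\cdots<i_k$ of the form $j(j+1)\cdots(j+k-1)$. LDE (layered decreasing envelope): decomposition of $\pi$ into decreasing subsequences ("paths") obtained by applying to the word $\pi$ the following recursive procedure. For a word $w=w_1\cdots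 w_r$ of distinct integers with $r\ge1$: the first path consists of all right-to-left maxima of $w$ (entries $w_i$ with $w_i>w_j$ for all $i<j\le r$; $w_r$ is always included). If the leftmost element of this path is $w_s$ with $s>1$, form the next path from the right-to-left maxima of $w_1\cdots w_{s-1}$, and so on, until a path containing $w_1$ is obtained. Then, for every path found and every two adjacent elements $w_a,w_b$ ($a<b$) of that path with $b>a+1$, apply the same procedure to the word $w_{a+1}\cdots w_{b-1}$. Continue until every entry is in a path. *)

theory Defs
  imports "HOL-Combinatorics.Multiset_Permutations" "HOL-Library.Sublist"
begin

definition integer_partition :: "nat \<Rightarrow> nat multiset \<Rightarrow> bool" where
  "integer_partition n p \<longleftrightarrow> 0 \<notin># p \<and> sum_mset p = n"

(* Permutations are words in one-line notation; positions are 0-based throughout. *)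
definition avoids_132 :: "nat list \<Rightarrow> bool" where
  "avoids_132 w \<longleftrightarrow>
     \<not> (\<exists>i j k. i < j \<and> j < k \<and> k < length w \<and> w ! i < w ! k \<and> w ! k < w ! j)"

definition S132 :: "nat \<Rightarrow> nat list set" where
  "S132 n = {w \<in> permutations_of_set {1..n}. avoids_132 w}"

(* A decomposition of a permutation is the set of the subsequences it consists of. As the
   entries are distinct, different subsequences are different words, so the set loses no
   multiplicities. *)
definition length_distribution :: "nat list set \<Rightarrow> nat multiset" where
  "length_distribution D = image_mset length (mset_set D)"

(* sublist: consecutive positions; subseq: arbitrary positions. *)
definition monotone_runs :: "(nat \<Rightarrow> nat \<Rightarrow> bool) \<Rightarrow> nat list \<Rightarrow> nat list set" where
  "monotone_runs R w =
     {u. u \<noteq> [] \<and> sublist u w \<and> sorted_wrt R u \<and>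
         (\<forall>v. sublist v w \<and> sorted_wrt R v \<and> sublist u v \<longrightarrow> v = u)}"

definition IRD :: "nat list \<Rightarrow> nat list set" where
  "IRD w = monotone_runs (<) w"

definition DRD :: "nat list \<Rightarrow> nat list set" where
  "DRD w = monotone_runs (>) w"

definition value_consecutive :: "nat list \<Rightarrow> bool" where
  "value_consecutive u \<longleftrightarrow> (\<exists>j k. u = [j..<j + k])"

definition vCIS :: "nat list \<Rightarrow> nat list set" where
  "vCIS w =
     {u. u \<noteq> [] \<and> subseq u w \<and> value_consecutive u \<and>
         (\<forall>v. subseq v w \<and> value_consecutive v \<and> subseq u v \<longrightarrow> v = u)}"

definition rl_maxima :: "nat list \<Rightarrow> nat list" where
  "rl_maxima w = filter (\<lambda>i. \<forall>j. i < j \<and> j < length w \<longrightarrow> w ! i > w ! j) [0..<length w]"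

lemma hd_rl_maxima_less:
  assumes "w \<noteq> []"
  shows "hd (rl_maxima w) < length w"
proof -
  have "length w - 1 \<in> set (rl_maxima w)"
    using assms by (auto simp: rl_maxima_def)
  then have "hd (rl_maxima w) \<in> set (rl_maxima w)"
    by (intro hd_in_set) auto
  then show ?thesis by (auto simp: rl_maxima_def)
qed

(* The paths found by repeatedly passing to the prefix that ends just before the leftmost
   element of the last path, each given as its increasing list of positions. Positions in a
   prefix of w are positions in w, so no index shift is needed. *)
function layer_paths :: "nat list \<Rightarrow> nat list list" where
  "layer_paths w =
     (if w = [] then [] else rl_maxima w # layer_paths (take (hd (rl_maxima w)) w))"
  by auto
termination
  by (relation "measure length") (auto simp: hd_rl_maxima_less)

declare layer_paths.simps [simp del]

(* The words w_{a+1} ... w_{b-1} for adjacent elements a, b of a path with b > a + 1. *)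
definition path_gaps :: "nat list \<Rightarrow> nat list \<Rightarrow> nat list set" where
  "path_gaps w p =
     {take (b - Suc a) (drop (Suc a) w) | a b. (a, b) \<in> set (zip p (tl p)) \<and> b > Suc a}"

lemma layer_paths_Nil [simp]: "layer_paths [] = []"
  by (simp add: layer_paths.simps)

lemma path_gaps_length:
  assumes "p \<in> set (layer_paths w)" and "v \<in> path_gaps w p"
  shows "length v < length w"
proof -
  have "w \<noteq> []" using assms(1) by auto
  then have "min (length w - Suc a) b < length w" for a b by (simp add: min_less_iff_disj)
  then show ?thesis using assms(2) by (auto simp: path_gaps_def)
qed

function LDE :: "nat list \<Rightarrow> nat list set" where
  "LDE w = map ((!) w) ` set (layer_paths w) \<union>
     (\<Union>p\<in>set (layer_paths w). \<Union>v\<in>path_gaps w p. LDE v)"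
  by auto
termination
  by (relation "measure length") (auto simp: path_gaps_length)

declare LDE.simps [simp del]

end

theory Submission
  imports Defs "HOL-Library.Tree"
begin

text \<open>
  A word avoiding 132 with maximum \<open>m\<close> has the form \<open>L m R\<close> with every entry of \<open>L\<close> above every
  entry of \<open>R\<close>; iterating this yields a binary tree. Under this correspondence the LDE lengths are
  the lengths of the maximal chains of right children, the v-CIS lengths those of the maximal
  chains of left children, and mirroring the tree turns IRD lengths into DRD lengths. Reversing,
  recursively, the order of the left subtrees along every chain of right children preserves the
  LDE lengths and turns v-CIS lengths into IRD lengths: in the tree with chain
  \<open>L\<^sub>1, \<dots>, L\<^sub>p\<close>, the part that can still grow lies in \<open>L\<^sub>1\<close> for v-CIS and in \<open>L\<^sub>p\<close> for IRD.
  Hence all four sets are counted by trees with prescribed left and right chain lengths, a count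
  that is symmetric by mirroring.
\<close>

section \<open>Blocks\<close>

lemma distinct_blocks:
  assumes "[] \<notin> set bs" "distinct (concat bs)"
  shows "distinct bs"
  using assms
proof (induction bs)
  case (Cons b bs)
  then show ?case by (cases b) auto
qed simp

lemma block_unique:
  assumes "distinct (concat bs)" "b \<in> set bs" "c \<in> set bs" "x \<in> set b" "x \<in> set c"
  shows "b = c"
  using assms by (induction bs) auto

text \<open>Nonempty disjoint blocks are pairwise different words, so passing from the list to its
  set loses no multiplicity.\<close>

lemma length_distribution_set:
  assumes "[] \<notin> set bs" "distinct (concat bs)"
  shows "length_distribution (set bs) = mset (map length bs)"
  using distinct_blocks[OF assms] by (simp add: length_distribution_def mset_set_set)

text \<open>The root value of a tree joins the neighbouring block of a subtree, or opens a block of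
  its own when there is none.\<close>

fun cons_hd :: "'a \<Rightarrow> 'a list list \<Rightarrow> 'a list list" where
  "cons_hd x [] = [[x]]"
| "cons_hd x (b # bs) = (x # b) # bs"

definition snoc_last :: "'a list list \<Rightarrow> 'a \<Rightarrow> 'a list list" where
  "snoc_last bs x = (if bs = [] then [[x]] else butlast bs @ [last bs @ [x]])"

lemma snoc_last_simps [simp]:
  "snoc_last [] x = [[x]]"
  "snoc_last (bs @ [b]) x = bs @ [b @ [x]]"
  by (simp_all add: snoc_last_def)

lemma concat_cons_hd [simp]: "concat (cons_hd x bs) = x # concat bs"
  by (cases bs) auto

lemma concat_snoc_last [simp]: "concat (snoc_last bs x) = concat bs @ [x]"
  by (cases bs rule: rev_cases) auto

lemma Nil_cons_hd [simp]: "[] \<notin> set bs \<Longrightarrow> [] \<notin> set (cons_hd x bs)"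
  by (cases bs) auto

lemma Nil_snoc_last [simp]: "[] \<notin> set bs \<Longrightarrow> [] \<notin> set (snoc_last bs x)"
  by (cases bs rule: rev_cases) auto

fun inc_hd :: "nat list \<Rightarrow> nat list" where
  "inc_hd [] = [1]"
| "inc_hd (a # as) = Suc a # as"

definition inc_last :: "nat list \<Rightarrow> nat list" where
  "inc_last as = rev (inc_hd (rev as))"

lemma inc_last_simps [simp]:
  "inc_last [] = [1]"
  "inc_last (as @ [a]) = as @ [Suc a]"
  by (simp_all add: inc_last_def)

lemma inc_hd_neq_Nil [simp]: "inc_hd as \<noteq> []"
  by (cases as) auto

lemma inc_last_neq_Nil [simp]: "inc_last as \<noteq> []"
  by (simp add: inc_last_def)

lemma map_length_cons_hd [simp]: "map length (cons_hd x bs) = inc_hd (map length bs)"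
  by (cases bs) auto

lemma map_length_snoc_last [simp]: "map length (snoc_last bs x) = inc_last (map length bs)"
  by (cases bs rule: rev_cases) auto

section \<open>Monotone runs\<close>

text \<open>A local certificate for maximal runs: adjacent blocks cannot be merged. It refers only
  to single blocks and junctions and so can be checked along the recursion on trees.\<close>

definition run_decomposition :: "(nat \<Rightarrow> nat \<Rightarrow> bool) \<Rightarrow> nat list list \<Rightarrow> bool" where
  "run_decomposition R bs \<longleftrightarrow>
     [] \<notin> set bs \<and> (\<forall>b\<in>set bs. sorted_wrt R b) \<and>
     successively (\<lambda>b c. \<not> R (last b) (hd c)) bs"

text \<open>A factor meeting two blocks would contain the last entry of one directly followed by the
  first entry of the next, and that pair violates \<open>R\<close>.\<close>

lemma sorted_sublist_of_run:
  assumes "run_decomposition R bs" "sublist u (concat bs)" "sorted_wrt R u" "u \<noteq> []"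
  shows "\<exists>b\<in>set bs. sublist u b"
  using assms
proof (induction bs)
  case (Cons b bs)
  have bs: "run_decomposition R bs" and b: "b \<noteq> []"
    using Cons.prems(1) by (auto simp: run_decomposition_def successively_Cons)
  consider "sublist u b" | "sublist u (concat bs)"
    | x y where "u = x @ y" "suffix x b" "prefix y (concat bs)" "x \<noteq> []" "y \<noteq> []"
    using Cons.prems(2) unfolding concat.simps sublist_append
    by (metis append.right_neutral append_Nil prefix_imp_sublist suffix_imp_sublist)
  then show ?case
  proof cases
    case 3
    then obtain c cs where bs_eq: "bs = c # cs" by (cases bs) auto
    have "c \<noteq> []" "\<not> R (last b) (hd c)"
      using Cons.prems(1) by (auto simp: bs_eq run_decomposition_def)
    moreover have "last b = last x" using 3(2,4) by (auto simp: suffix_def)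
    moreover have "hd c = hd y"
    proof -
      obtain z where "concat bs = y @ z" using 3(3) by (auto simp: prefix_def)
      then have "hd (concat bs) = hd y" using 3(5) by simp
      then show ?thesis using \<open>c \<noteq> []\<close> by (simp add: bs_eq)
    qed
    moreover have "R (last x) (hd y)"
      using Cons.prems(3) 3 by (auto simp: sorted_wrt_append)
    ultimately show ?thesis by simp
  qed (use Cons.IH[OF bs] Cons.prems in auto)
qed simp

text \<open>A sorted factor \<open>v\<close> containing a block \<open>b\<close> lies in some block
  \<open>c\<close>. Both blocks contain \<open>hd b\<close>, so disjointness gives
  \<open>b = c\<close>, and \<open>v\<close> is squeezed to \<open>b\<close>.\<close>

lemma monotone_runs_concat:
  assumes "run_decomposition R bs" "distinct (concat bs)"
  shows "monotone_runs R (concat bs) = set bs"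
proof -
  have block: "b \<noteq> [] \<and> sublist b (concat bs) \<and> sorted_wrt R b" if b: "b \<in> set bs" for b
  proof -
    obtain xs ys where "bs = xs @ b # ys" using split_list[OF b] by blast
    then have "sublist b (concat bs)" by simp
    then show ?thesis using assms(1) b by (auto simp: run_decomposition_def)
  qed
  have "v = b"
    if b: "b \<in> set bs" and v: "sublist v (concat bs)" "sorted_wrt R v" and bv: "sublist b v"
    for b v
  proof -
    have "v \<noteq> []" using block[OF b] bv by auto
    then obtain c where c: "c \<in> set bs" "sublist v c"
      using sorted_sublist_of_run[OF assms(1) v] by blast
    have hd: "hd b \<in> set b" using block[OF b] by simp
    then have "hd b \<in> set c"
      using set_mono_sublist[OF bv] set_mono_sublist[OF c(2)] by blast
    then have "b = c" by (rule block_unique[OF assms(2) b c(1) hd])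
    then show ?thesis using bv c(2) by (simp add: sublist_order.order.antisym)
  qed
  moreover have "u \<in> set bs"
    if "u \<noteq> []" "sublist u (concat bs)" "sorted_wrt R u"
      "\<forall>v. sublist v (concat bs) \<and> sorted_wrt R v \<and> sublist u v \<longrightarrow> v = u" for u
    using sorted_sublist_of_run[OF assms(1) that(2,3,1)] block that(4) by metis
  ultimately show ?thesis
    using block unfolding monotone_runs_def by blast
qed

lemma run_decomposition_append:
  "run_decomposition R (bs @ cs) \<longleftrightarrow>
     run_decomposition R bs \<and> run_decomposition R cs \<and>
     (bs = [] \<or> cs = [] \<or> \<not> R (last (last bs)) (hd (hd cs)))"
  by (auto simp: run_decomposition_def successively_append_iff)

lemma run_decomposition_cons_hd:
  assumes "run_decomposition R bs" "\<forall>y\<in>set (concat bs). R x y"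
  shows "run_decomposition R (cons_hd x bs)"
  using assms by (cases bs) (auto simp: run_decomposition_def successively_Cons)

lemma run_decomposition_snoc_last:
  assumes "run_decomposition R bs" "\<forall>y\<in>set (concat bs). R y x"
  shows "run_decomposition R (snoc_last bs x)"
  using assms
  by (cases bs rule: rev_cases)
    (auto simp: run_decomposition_def successively_append_iff sorted_wrt_append)

section \<open>Permutations avoiding 132 as binary trees\<close>

text \<open>The base \<open>k\<close> varies because the left subtree takes the upper part of the
  value interval, above the \<open>size r\<close> values of the right subtree.\<close>

fun perm_word :: "nat \<Rightarrow> 'a tree \<Rightarrow> nat list" where
  "perm_word k \<langle>\<rangle> = []"
| "perm_word k \<langle>l, _, r\<rangle> = perm_word (k + size r) l @ (k + size l + size r) # perm_word k r"

lemma length_perm_word [simp]: "length (perm_word k t) = size t"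
  by (induction k t rule: perm_word.induct) auto

lemma set_perm_word [simp]: "set (perm_word k t) = {k..<k + size t}"
  by (induction k t rule: perm_word.induct) auto

lemma distinct_perm_word [simp]: "distinct (perm_word k t)"
  by (induction k t rule: perm_word.induct) auto

lemma perm_word_eq_Nil [simp]: "perm_word k t = [] \<longleftrightarrow> t = \<langle>\<rangle>"
  by (cases t) auto

section \<open>Avoidance of 132 at the maximum, and recovery of the tree from the word\<close>

lemma avoids_132_sublist:
  assumes "avoids_132 (p @ u @ q)"
  shows "avoids_132 u"
  unfolding avoids_132_def
proof safe
  fix i j k assume *: "i < j" "j < k" "k < length u" "u ! i < u ! k" "u ! k < u ! j"
  have nth: "(p @ u @ q) ! (length p + a) = u ! a" if "a < length u" for a
    using that by (simp add: nth_append)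
  have "length p + i < length p + j" "length p + j < length p + k"
    "length p + k < length (p @ u @ q)"
    using * by simp_all
  moreover have "(p @ u @ q) ! (length p + i) < (p @ u @ q) ! (length p + k)"
    "(p @ u @ q) ! (length p + k) < (p @ u @ q) ! (length p + j)"
    using * by (subst (1 2) nth; simp)+
  ultimately show False using assms unfolding avoids_132_def by blast
qed

text \<open>An entry of \<open>L\<close> below an entry of \<open>R\<close> would form 132 with
  \<open>m\<close> between them. Conversely, the last entry of an occurrence is never
  \<open>m\<close>, as the middle one exceeds it; if it lies in \<open>R\<close>, the smaller first
  entry must lie in \<open>R\<close> too, and otherwise the whole occurrence lies in
  \<open>L\<close>.\<close>

lemma avoids_132_max_split:
  assumes "\<forall>x\<in>set L. x < m" "\<forall>y\<in>set R. y < m"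
  shows "avoids_132 (L @ m # R) \<longleftrightarrow>
           avoids_132 L \<and> avoids_132 R \<and> (\<forall>x\<in>set L. \<forall>y\<in>set R. y \<le> x)"
proof (intro iffI conjI ballI)
  let ?w = "L @ m # R"
  assume w: "avoids_132 ?w"
  show "avoids_132 L" using avoids_132_sublist[of "[]" L "m # R"] w by simp
  show "avoids_132 R" using avoids_132_sublist[of "L @ [m]" R "[]"] w by simp
  fix x y assume "x \<in> set L" "y \<in> set R"
  then obtain i k where ik: "i < length L" "L ! i = x" "k < length R" "R ! k = y"
    by (auto simp: in_set_conv_nth)
  have "i < length L" "length L < length L + Suc k" "length L + Suc k < length ?w"
    "?w ! i = x" "?w ! (length L + Suc k) = y" "?w ! length L = m"
    using ik by (simp_all add: nth_append)
  moreover have "y < m" using assms \<open>y \<in> set R\<close> by blast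
  ultimately show "y \<le> x"
    using w unfolding avoids_132_def by (metis not_le)
next
  let ?w = "L @ m # R"
  assume *: "avoids_132 L \<and> avoids_132 R \<and> (\<forall>x\<in>set L. \<forall>y\<in>set R. y \<le> x)"
  have le_m: "?w ! a \<le> m" if "a < length ?w" for a
    using nth_mem[OF that] assms by auto
  show "avoids_132 ?w"
    unfolding avoids_132_def
  proof safe
    fix i j k assume ijk: "i < j" "j < k" "k < length ?w" "?w ! i < ?w ! k" "?w ! k < ?w ! j"
    show False
    proof (cases "k < length L")
      case True
      then show False using * ijk unfolding avoids_132_def by (auto simp: nth_append)
    next
      case False
      have "k \<noteq> length L" using ijk le_m[of j] by auto
      with False obtain k' where k': "k = length L + Suc k'" "k' < length R"
        using ijk(3) less_imp_Suc_add[of "length L" k] by auto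
      have "?w ! k \<in> set R" using k' by (simp add: nth_append)
      have "i > length L"
      proof (rule ccontr)
        assume "\<not> i > length L"
        then have "?w ! i \<in> set L \<or> ?w ! i = m" by (auto simp: nth_append)
        then have "?w ! k \<le> ?w ! i" using \<open>?w ! k \<in> set R\<close> * assms by auto
        then show False using ijk by simp
      qed
      then obtain i' j' where i': "i = length L + Suc i'" and j': "j = length L + Suc j'"
        using ijk(1) less_imp_Suc_add[of "length L" i] less_imp_Suc_add[of "length L" j] by auto
      show False using * ijk k' unfolding i' j' avoids_132_def
        by (auto simp: nth_append)
    qed
  qed
qed

lemma avoids_132_perm_word: "avoids_132 (perm_word k t)"
proof (induction k t rule: perm_word.induct)
  case 1
  show ?case by (simp add: avoids_132_def)
next
  case (2 k l x r)
  then show ?case by (subst perm_word.simps, subst avoids_132_max_split) auto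
qed

text \<open>Members of \<open>A\<close> exceed all of \<open>B\<close>, so everything in the
  interval up to \<open>Max B\<close> belongs to \<open>B\<close>. Hence the lengths of the two
  sides of the maximum determine their value ranges.\<close>

lemma down_closed_interval:
  fixes k m :: nat
  assumes "A \<union> B = {k..<m}" "\<forall>x\<in>A. \<forall>y\<in>B. y < x"
  shows "B = {k..<k + card B}" "A = {k + card B..<m}"
proof -
  have "\<exists>c\<ge>k. B = {k..<c}"
  proof (cases "B = {}")
    case False
    have fin: "finite B" using assms(1) by (metis finite_Un finite_atLeastLessThan)
    then have "Max B \<in> B" using False by simp
    have "B = {k..<Suc (Max B)}"
    proof (intro equalityI subsetI)
      fix y assume "y \<in> B"
      then show "y \<in> {k..<Suc (Max B)}" using assms(1) fin by (auto simp: less_Suc_eq_le)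
    next
      fix y assume y: "y \<in> {k..<Suc (Max B)}"
      have "Max B < m" using assms(1) \<open>Max B \<in> B\<close> by auto
      then have "y \<in> A \<union> B" using assms(1) y by auto
      then show "y \<in> B" using y \<open>Max B \<in> B\<close> assms(2) by force
    qed
    moreover have "k \<le> Max B" using \<open>Max B \<in> B\<close> assms(1) by auto
    ultimately show ?thesis by (meson le_SucI)
  qed auto
  then obtain c where c: "k \<le> c" "B = {k..<c}" by blast
  then show B: "B = {k..<k + card B}" by simp
  have "A = (A \<union> B) - B" using assms(2) by blast
  then show "A = {k + card B..<m}" using assms(1) B c by auto
qed

text \<open>Splitting at the maximum leaves two shorter 132-avoiding words on intervals, which
  become the subtrees.\<close>

lemma ex_perm_word:
  assumes "distinct w" "set w = {k..<k + n}" "avoids_132 w"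
  shows "\<exists>t::unit tree. size t = n \<and> perm_word k t = w"
  using assms
proof (induction n arbitrary: k w rule: less_induct)
  case (less n)
  have len: "length w = n" using less.prems distinct_card[of w] by simp
  show ?case
  proof (cases "n = 0")
    case True
    then show ?thesis using len by (intro exI[of _ "\<langle>\<rangle>"]) auto
  next
    case False
    define m where "m = k + n - 1"
    have "m \<in> set w" using less.prems(2) False by (auto simp: m_def)
    then obtain L R where w: "w = L @ m # R" by (auto dest: split_list)
    have LR: "set L \<union> set R = {k..<m}"
    proof -
      have "set L \<union> set R = set w - {m}" using less.prems(1) w by auto
      also have "\<dots> = {k..<m}" using less.prems(2) False by (auto simp: m_def)
      finally show ?thesis .
    qed
    have av: "avoids_132 L" "avoids_132 R" "\<forall>x\<in>set L. \<forall>y\<in>set R. y \<le> x"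
      using less.prems(3) LR avoids_132_max_split[of L m R] unfolding w
      by (metis UnCI atLeastLessThan_iff)+
    \<comment> \<open>Avoidance gives only the weak inequality; distinctness makes it
      strict.\<close>
    have "\<forall>x\<in>set L. \<forall>y\<in>set R. y < x"
      using av(3) less.prems(1) w by (auto simp: le_less)
    note intervals = down_closed_interval[OF LR this]
    have dist: "distinct L" "distinct R" using less.prems(1) w by auto
    have n: "n = Suc (length L + length R)" using len w by simp
    have "set R = {k..<k + length R}" using intervals(1) dist by (simp add: distinct_card)
    then obtain r :: "unit tree" where r: "size r = length R" "perm_word k r = R"
      using less.IH[of "length R" R k] dist av n by auto
    have "set L = {k + length R..<(k + length R) + length L}"
      using intervals(2) dist n by (simp add: distinct_card m_def ac_simps)
    then obtain l :: "unit tree" where l: "size l = length L" "perm_word (k + length R) l = L"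
      using less.IH[of "length L" L "k + length R"] dist av n by auto
    show ?thesis
      using l r n by (intro exI[of _ "\<langle>l, (), r\<rangle>"]) (simp add: w m_def)
  qed
qed

lemma perm_word_inject:
  fixes s t :: "unit tree"
  assumes "perm_word k s = perm_word k t"
  shows "s = t"
  using assms
proof (induction s arbitrary: k t)
  case Leaf
  then show ?case by (metis perm_word.simps(1) perm_word_eq_Nil)
next
  case (Node l x r)
  then obtain l' y r' where t: "t = \<langle>l', y, r'\<rangle>"
    by (metis perm_word_eq_Nil neq_Leaf_iff tree.distinct(1))
  \<comment> \<open>Equal sizes make both root values the same number. It exceeds all entries of the
    subwords, so the word splits at it in only one way.\<close>
  have "size \<langle>l, x, r\<rangle> = size t" using Node.prems by (metis length_perm_word)
  then have "perm_word (k + size r) l @ (k + size l + size r) # perm_word k r =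
    perm_word (k + size r') l' @ (k + size l + size r) # perm_word k r'"
    using Node.prems by (simp add: t)
  then have eq: "perm_word (k + size r) l = perm_word (k + size r') l'"
    "perm_word k r = perm_word k r'"
    by (auto simp: append_Cons_eq_iff)
  have "r = r'" using Node.IH(2) eq(2) by blast
  then show ?case using Node.IH(1) eq(1) by (simp add: t)
qed

lemma bij_betw_perm_word: "bij_betw (perm_word 1) {t::unit tree. size t = n} (S132 n)"
proof (rule bij_betw_imageI)
  show "inj_on (perm_word 1) {t::unit tree. size t = n}"
    by (auto intro: inj_onI perm_word_inject)
  show "perm_word 1 ` {t::unit tree. size t = n} = S132 n"
    using ex_perm_word[where k = 1 and n = n]
    by (force simp: S132_def permutations_of_set_def avoids_132_perm_word)
qed

section \<open>The four statistics on trees\<close>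

text \<open>The maximum ends the last increasing run of the left part, and whatever follows it
  starts with a descent.\<close>

fun ird_blocks :: "nat \<Rightarrow> 'a tree \<Rightarrow> nat list list" where
  "ird_blocks k \<langle>\<rangle> = []"
| "ird_blocks k \<langle>l, _, r\<rangle> =
     snoc_last (ird_blocks (k + size r) l) (k + size l + size r) @ ird_blocks k r"

text \<open>The maximum is reached by an ascent and continues downwards into the first decreasing
  run of the right part.\<close>

fun drd_blocks :: "nat \<Rightarrow> 'a tree \<Rightarrow> nat list list" where
  "drd_blocks k \<langle>\<rangle> = []"
| "drd_blocks k \<langle>l, _, r\<rangle> =
     drd_blocks (k + size r) l @ cons_hd (k + size l + size r) (drd_blocks k r)"

text \<open>The first block is the outermost path: the maximum followed by the right-to-left maxima
  of the right part.\<close>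

fun lde_blocks :: "nat \<Rightarrow> 'a tree \<Rightarrow> nat list list" where
  "lde_blocks k \<langle>\<rangle> = []"
| "lde_blocks k \<langle>l, _, r\<rangle> =
     cons_hd (k + size l + size r) (lde_blocks k r) @ lde_blocks (k + size r) l"

text \<open>Blocks are listed by value rather than by position, so the right subtree comes first.
  The maximum extends the block that holds its predecessor, the largest value of the left
  part.\<close>

fun vcis_blocks :: "nat \<Rightarrow> 'a tree \<Rightarrow> nat list list" where
  "vcis_blocks k \<langle>\<rangle> = []"
| "vcis_blocks k \<langle>l, _, r\<rangle> =
     vcis_blocks k r @ snoc_last (vcis_blocks (k + size r) l) (k + size l + size r)"

lemma concat_ird_blocks [simp]: "concat (ird_blocks k t) = perm_word k t"
  by (induction k t rule: ird_blocks.induct) auto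

lemma concat_drd_blocks [simp]: "concat (drd_blocks k t) = perm_word k t"
  by (induction k t rule: drd_blocks.induct) auto

lemma concat_vcis_blocks [simp]: "concat (vcis_blocks k t) = [k..<k + size t]"
proof (induction k t rule: vcis_blocks.induct)
  case (2 k l x r)
  have "[k..<k + size r] @ [k + size r..<k + size r + size l] = [k..<k + size r + size l]"
    by (metis le_add1 upt_add_eq_append)
  then show ?case using 2 by (simp add: ac_simps)
qed simp

lemma mset_concat_lde_blocks: "mset (concat (lde_blocks k t)) = mset (perm_word k t)"
  by (induction k t rule: lde_blocks.induct) auto

lemma Nil_notin_blocks [simp]:
  "[] \<notin> set (ird_blocks k t)" "[] \<notin> set (drd_blocks k t)"
  "[] \<notin> set (lde_blocks k t)" "[] \<notin> set (vcis_blocks k t)"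
  by (induction t arbitrary: k) auto

lemma hd_concat: "bs \<noteq> [] \<Longrightarrow> [] \<notin> set bs \<Longrightarrow> hd (hd bs) = hd (concat bs)"
  by (cases bs) auto

lemma last_concat: "bs \<noteq> [] \<Longrightarrow> [] \<notin> set bs \<Longrightarrow> last (last bs) = last (concat bs)"
  by (cases bs rule: rev_cases) auto

lemma IRD_perm_word: "IRD (perm_word k t) = set (ird_blocks k t)"
proof -
  have "run_decomposition (<) (ird_blocks k t)"
  proof (induction k t rule: ird_blocks.induct)
    case (2 k l x r)
    have "hd (perm_word k r) < k + size r" if "ird_blocks k r \<noteq> []"
      using that hd_in_set[of "perm_word k r"] by (cases r) auto
    then show ?case
      using 2
      by (auto simp: run_decomposition_append hd_concat last_concat
          intro!: run_decomposition_snoc_last)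
  qed (simp add: run_decomposition_def)
  from monotone_runs_concat[OF this] show ?thesis by (simp add: IRD_def)
qed

lemma DRD_perm_word: "DRD (perm_word k t) = set (drd_blocks k t)"
proof -
  have "run_decomposition (>) (drd_blocks k t)"
  proof (induction k t rule: drd_blocks.induct)
    case (2 k l x r)
    have "last (perm_word (k + size r) l) < k + size l + size r"
      if "drd_blocks (k + size r) l \<noteq> []"
      using that last_in_set[of "perm_word (k + size r) l"] by (cases l) auto
    then show ?case
      using 2
      by (auto simp: run_decomposition_append hd_concat last_concat
          intro!: run_decomposition_cons_hd)
  qed (simp add: run_decomposition_def)
  from monotone_runs_concat[OF this] show ?thesis by (simp add: DRD_def)
qed

section \<open>The layered decreasing envelope\<close>

lemma layer_paths_less:
  "p \<in> set (layer_paths w) \<Longrightarrow> i \<in> set p \<Longrightarrow> i < length w"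
proof (induction w rule: layer_paths.induct)
  case (1 w)
  have "w \<noteq> []" using "1.prems"(1) by auto
  then consider "p = rl_maxima w" | "p \<in> set (layer_paths (take (hd (rl_maxima w)) w))"
    using "1.prems"(1) layer_paths.simps[of w] by auto
  then show ?case
  proof cases
    case 1
    then show ?thesis using "1.prems"(2) by (simp add: rl_maxima_def)
  next
    case 2
    then show ?thesis using "1.IH"[OF \<open>w \<noteq> []\<close> 2 "1.prems"(2)] by simp
  qed
qed

lemma zip_tl_in_set:
  assumes "(a, b) \<in> set (zip p (tl p))"
  shows "a \<in> set p" "b \<in> set p"
  using assms by (cases p; auto dest: set_zip_leftD set_zip_rightD)+

text \<open>Later layers are found in prefixes, while \<open>LDE\<close> reads their gaps in the
  whole word; the truncation lies beyond all positions involved.\<close>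

lemma path_gaps_take:
  assumes "\<forall>i\<in>set p. i < h"
  shows "path_gaps (take h w) p = path_gaps w p"
proof -
  have "take (b - Suc a) (drop (Suc a) (take h w)) = take (b - Suc a) (drop (Suc a) w)"
    if "(a, b) \<in> set (zip p (tl p))" for a b
    using zip_tl_in_set[OF that] assms by (auto simp: drop_take)
  then show ?thesis unfolding path_gaps_def by (metis (no_types, lifting))
qed

text \<open>In the recursion for \<open>LDE\<close> the first path plays a special role, as a new maximum in front of
  the word is prepended to it; \<open>lde_rest\<close> collects all other paths.\<close>
definition rl_maxima_word :: "nat list \<Rightarrow> nat list" where
  "rl_maxima_word w = map ((!) w) (rl_maxima w)"

definition lde_rest :: "nat list \<Rightarrow> nat list set" where
  "lde_rest w = (\<Union>v\<in>path_gaps w (rl_maxima w). LDE v) \<union> LDE (take (hd (rl_maxima w)) w)"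

lemma LDE_Nil [simp]: "LDE [] = {}"
  by (subst LDE.simps) simp

lemma rl_maxima_Nil [simp]: "rl_maxima [] = []"
  by (simp add: rl_maxima_def)

lemma rl_maxima_word_Nil [simp]: "rl_maxima_word [] = []"
  by (simp add: rl_maxima_word_def)

lemma lde_rest_Nil [simp]: "lde_rest [] = {}"
  by (simp add: lde_rest_def path_gaps_def)

text \<open>The layers after the first are exactly the layers of the prefix before its leftmost
  element. Their words and gaps are the same in the prefix and in \<open>w\<close>, so together they
  contribute \<open>LDE\<close> of the prefix.\<close>

lemma LDE_eq_insert:
  assumes "w \<noteq> []"
  shows "LDE w = insert (rl_maxima_word w) (lde_rest w)"
proof -
  let ?h = "hd (rl_maxima w)"
  let ?u = "take ?h w"
  have less: "i < ?h" if "p \<in> set (layer_paths ?u)" "i \<in> set p" for p i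
    using layer_paths_less[OF that] by simp
  have words: "map ((!) ?u) p = map ((!) w) p" if "p \<in> set (layer_paths ?u)" for p
    using less[OF that] by simp
  have gaps: "path_gaps ?u p = path_gaps w p" if "p \<in> set (layer_paths ?u)" for p
    using less[OF that] by (simp add: path_gaps_take)
  have "LDE ?u = map ((!) w) ` set (layer_paths ?u) \<union>
      (\<Union>p\<in>set (layer_paths ?u). \<Union>v\<in>path_gaps w p. LDE v)"
    by (subst LDE.simps) (simp add: words gaps cong: image_cong)
  moreover have "layer_paths w = rl_maxima w # layer_paths ?u"
    using assms by (subst layer_paths.simps) simp
  ultimately show ?thesis
    by (subst LDE.simps) (auto simp: rl_maxima_word_def lde_rest_def)
qed

text \<open>The maximum eliminates every position before it and leaves comparisons behind it
  unaffected; positions of \<open>R\<close> reappear shifted past \<open>L\<close> and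
  \<open>m\<close>.\<close>

lemma rl_maxima_max_split:
  assumes "\<forall>x\<in>set L. x < m" "\<forall>y\<in>set R. y < m"
  shows "rl_maxima (L @ m # R) = length L # map (\<lambda>i. i + Suc (length L)) (rl_maxima R)"
proof -
  let ?w = "L @ m # R" and ?s = "\<lambda>i. i + Suc (length L)"
  let ?P = "\<lambda>i. \<forall>j. i < j \<and> j < length ?w \<longrightarrow> ?w ! j < ?w ! i"
  have "[0..<length ?w] = [0..<length L] @ length L # map ?s [0..<length R]"
  proof -
    have "[0..<length ?w] = [0..<length L] @ [length L..<length L + Suc (length R)]"
      using upt_add_eq_append[of 0 "length L" "Suc (length R)"] by simp
    also have "[length L..<length L + Suc (length R)] =
        length L # [Suc (length L)..<length R + Suc (length L)]"
      by (simp add: upt_conv_Cons ac_simps del: upt_Suc)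
    finally show ?thesis by (simp only: map_add_upt)
  qed
  moreover have "filter ?P [0..<length L] = []"
  proof -
    have "\<not> ?P i" if "i < length L" for i
    proof
      assume "?P i"
      from this[rule_format, of "length L"] have "?w ! length L < ?w ! i" using that by simp
      moreover have "L ! i < m" using that assms by simp
      ultimately show False using that by (simp add: nth_append)
    qed
    then show ?thesis by (simp add: filter_empty_conv)
  qed
  moreover have "?P (length L)"
    using assms by (auto simp: nth_append nth_Cons')
  moreover have "filter (?P \<circ> ?s) [0..<length R] = rl_maxima R"
  proof -
    have "?P (?s i) \<longleftrightarrow> (\<forall>j. i < j \<and> j < length R \<longrightarrow> R ! j < R ! i)"
      if "i < length R" for i
    proof
      assume *: "?P (?s i)"
      show "\<forall>j. i < j \<and> j < length R \<longrightarrow> R ! j < R ! i"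
      proof safe
        fix j assume "i < j" "j < length R"
        then show "R ! j < R ! i" using *[rule_format, of "?s j"] by (simp add: nth_append)
      qed
    next
      assume *: "\<forall>j. i < j \<and> j < length R \<longrightarrow> R ! j < R ! i"
      show "?P (?s i)"
      proof safe
        fix j assume j: "?s i < j" "j < length ?w"
        then obtain j' where "j = ?s j'" by (metis add.commute less_imp_add_positive add.left_commute)
        then show "?w ! j < ?w ! ?s i" using * j by (simp add: nth_append)
      qed
    qed
    then show ?thesis unfolding rl_maxima_def by (intro filter_cong) auto
  qed
  ultimately show ?thesis
    unfolding rl_maxima_def[of ?w] by (simp only: filter_append filter.simps filter_map append_Nil split: if_split) blast
qed

lemma rl_maxima_word_max_split:
  assumes "\<forall>x\<in>set L. x < m" "\<forall>y\<in>set R. y < m"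
  shows "rl_maxima_word (L @ m # R) = m # rl_maxima_word R"
  by (simp add: rl_maxima_word_def rl_maxima_max_split[OF assms] nth_append)

lemma path_gaps_shift:
  "path_gaps (L @ m # R) (map (\<lambda>i. i + Suc (length L)) p) = path_gaps R p"
  by (force simp: path_gaps_def zip_map_map simp flip: map_tl)

lemma path_gaps_Cons:
  "path_gaps w (a # b # p) =
     (if b > Suc a then {take (b - Suc a) (drop (Suc a) w)} else {}) \<union> path_gaps w (b # p)"
  by (auto simp: path_gaps_def)

text \<open>The prefix of \<open>R\<close> before its first right-to-left maximum starts a new layer
  in \<open>R\<close>, but after prepending \<open>m\<close> it becomes the gap behind
  \<open>m\<close>. It contributes the same envelope in either role. The new prefix to be layered is
  \<open>L\<close>.\<close>

lemma lde_rest_max_split: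
  assumes "\<forall>x\<in>set L. x < m" "\<forall>y\<in>set R. y < m"
  shows "lde_rest (L @ m # R) = lde_rest R \<union> LDE L"
proof (cases "rl_maxima R")
  case Nil
  moreover from Nil have "R = []"
    using hd_rl_maxima_less[of R] by (cases R) (auto simp: rl_maxima_def filter_empty_conv)
  ultimately show ?thesis
    unfolding lde_rest_def rl_maxima_max_split[OF assms] by (simp add: path_gaps_def)
next
  case (Cons h q)
  let ?s = "\<lambda>i. i + Suc (length L)"
  have "path_gaps (L @ m # R) (rl_maxima (L @ m # R)) =
      (if h > 0 then {take h R} else {}) \<union> path_gaps R (rl_maxima R)"
    using path_gaps_shift[of L m R "h # q"]
    by (simp add: rl_maxima_max_split[OF assms] Cons path_gaps_Cons)
  \<comment> \<open>For \<open>h = 0\<close> there is no gap, in agreement with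
    \<open>LDE []\<close> being empty.\<close>
  then have "(\<Union>v\<in>path_gaps (L @ m # R) (rl_maxima (L @ m # R)). LDE v) =
      LDE (take h R) \<union> (\<Union>v\<in>path_gaps R (rl_maxima R). LDE v)"
    by auto
  then show ?thesis
    unfolding lde_rest_def by (auto simp: rl_maxima_max_split[OF assms] Cons)
qed

lemma lde_blocks_eq_Nil [simp]: "lde_blocks k t = [] \<longleftrightarrow> t = \<langle>\<rangle>"
  using map_length_cons_hd inc_hd_neq_Nil by (cases t) (auto dest: arg_cong[of _ _ "map length"])

lemma LDE_perm_word: "LDE (perm_word k t) = set (lde_blocks k t)"
proof -
  \<comment> \<open>The first path is tracked separately from the rest, since prepending a maximum
    lengthens precisely this path. The guard avoids \<open>hd []\<close>.\<close>
  have "(t \<noteq> \<langle>\<rangle> \<longrightarrow> rl_maxima_word (perm_word k t) = hd (lde_blocks k t)) \<and>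
      lde_rest (perm_word k t) = set (tl (lde_blocks k t)) \<and>
      LDE (perm_word k t) = set (lde_blocks k t)"
  proof (induction k t rule: lde_blocks.induct)
    case (2 k l x r)
    let ?L = "perm_word (k + size r) l" and ?R = "perm_word k r" and ?m = "k + size l + size r"
    have less: "\<forall>x\<in>set ?L. x < ?m" "\<forall>y\<in>set ?R. y < ?m" by auto
    have hd: "rl_maxima_word (?L @ ?m # ?R) = hd (cons_hd ?m (lde_blocks k r))"
      unfolding rl_maxima_word_max_split[OF less] using "2.IH"(1)
      by (cases "r = \<langle>\<rangle>"; cases "lde_blocks k r") auto
    have tl: "lde_rest (?L @ ?m # ?R) =
        set (tl (cons_hd ?m (lde_blocks k r) @ lde_blocks (k + size r) l))"
      unfolding lde_rest_max_split[OF less] using "2.IH"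
      by (cases "lde_blocks k r") auto
    have ne: "cons_hd ?m (lde_blocks k r) \<noteq> []" by (cases "lde_blocks k r") auto
    show ?case
      using hd tl ne LDE_eq_insert[of "?L @ ?m # ?R"]
      by (cases "cons_hd ?m (lde_blocks k r)") (auto simp del: lde_blocks.simps simp: lde_blocks.simps(2))
  qed simp
  then show ?thesis by blast
qed

section \<open>Value-consecutive increasing subsequences\<close>

lemma value_consecutive_sublist_upt:
  assumes "sublist u [a..<b]"
  shows "value_consecutive u"
proof -
  obtain p q where pq: "[a..<b] = p @ u @ q" using assms by (auto simp: sublist_def)
  show ?thesis
  proof (cases "u = []")
    case True
    then show ?thesis by (auto simp: value_consecutive_def intro!: exI[of _ 0])
  next
    case False
    have "a + length p + length u \<le> b"
      using arg_cong[OF pq, of length] False by (cases "a \<le> b") auto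
    moreover have "u = take (length u) (drop (length p) [a..<b])" by (simp add: pq)
    ultimately have "u = [a + length p..<a + length p + length u]"
      by (simp add: drop_upt take_upt)
    then show ?thesis unfolding value_consecutive_def by blast
  qed
qed

lemma value_consecutive_append1:
  assumes "value_consecutive (u @ [m])" "u \<noteq> []"
  shows "value_consecutive u" "last u = m - 1"
proof -
  obtain a c where ac: "u @ [m] = [a..<a + c]" using assms(1) by (auto simp: value_consecutive_def)
  have "c \<noteq> 0" using ac by (auto intro: ccontr)
  then obtain d where d: "c = Suc d" by (cases c) auto
  then have u: "u = [a..<a + d]" "m = a + d" using ac by auto
  then have "d > 0" using assms(2) by (cases d) auto
  then show "value_consecutive u" "last u = m - 1"
    using u by (auto simp: value_consecutive_def)
qed

lemma value_consecutive_sorted: "value_consecutive u \<Longrightarrow> sorted_wrt (<) u"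
  by (auto simp: value_consecutive_def)

lemma set_mono_subseq: "subseq u w \<Longrightarrow> set u \<subseteq> set w"
  by (auto elim: list_emb_set)

lemma subseq_vcis_blocks:
  "b \<in> set (vcis_blocks k t) \<Longrightarrow> subseq b (perm_word k t)"
proof (induction k t arbitrary: b rule: vcis_blocks.induct)
  case (2 k l x r)
  let ?L = "perm_word (k + size r) l" and ?R = "perm_word k r" and ?m = "k + size l + size r"
  consider "b \<in> set (vcis_blocks k r)" | "b \<in> set (vcis_blocks (k + size r) l)"
    | c where "subseq c ?L" "b = c @ [?m]"
    using 2 by (cases "vcis_blocks (k + size r) l" rule: rev_cases) auto
  then show ?case
  proof cases
    case 1
    then show ?thesis using 2 by (auto intro: subseq_drop_many)
  next
    case 2
    then show ?thesis using "2.IH" by (auto intro: list_emb_prefix)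
  next
    case 3
    then show ?thesis by (auto intro: list_emb_append_mono)
  qed
qed simp

text \<open>Values of \<open>?R\<close> lie below \<open>?m\<close> and below all values of
  \<open>?L\<close>, so an increasing \<open>u\<close> cannot pass from \<open>?L\<close> or
  \<open>?m\<close> into \<open>?R\<close>. It lies in one subword or has the form
  \<open>u1 @ [?m]\<close>; in the latter case a nonempty \<open>u1\<close> ends in
  \<open>?m - 1\<close>, which locates its block.\<close>

lemma value_consecutive_in_block:
  assumes "subseq u (perm_word k t)" "value_consecutive u" "u \<noteq> []"
  shows "\<exists>b\<in>set (vcis_blocks k t). subseq u b"
  using assms
proof (induction k t arbitrary: u rule: vcis_blocks.induct)
  case (2 k l x r)
  let ?L = "perm_word (k + size r) l" and ?R = "perm_word k r" and ?m = "k + size l + size r"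
  let ?B = "vcis_blocks (k + size r) l"
  obtain u1 u2 where u: "u = u1 @ u2" "subseq u1 ?L" "subseq u2 (?m # ?R)"
    using "2.prems"(1) by (auto elim: subseq_appendE)
  have sorted: "sorted_wrt (<) (u1 @ u2)"
    using value_consecutive_sorted[OF "2.prems"(2)] u by simp
  have u1: "set u1 \<subseteq> {k + size r..<?m}"
    using set_mono_subseq[OF u(2)] by (simp add: ac_simps)
  consider "u2 = []" | "subseq u2 ?R" "u2 \<noteq> []" | u3 where "u2 = ?m # u3" "subseq u3 ?R"
    using u(3) by (cases u2) (auto split: if_splits)
  then show ?case
  proof cases
    case 1
    then obtain b where "b \<in> set ?B" "subseq u b" using "2.IH"(2)[of u] "2.prems" u by auto
    then show ?thesis
      by (cases ?B rule: rev_cases) (auto intro: list_emb_prefix)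
  next
    case 2
    have "u1 = []"
    proof (rule ccontr)
      assume "u1 \<noteq> []"
      then have "hd u1 \<in> set u1" "hd u2 \<in> set u2" using 2 by auto
      then have "hd u1 < hd u2" "k + size r \<le> hd u1" "hd u2 < k + size r"
        using sorted u1 set_mono_subseq[OF 2(1)] by (auto simp: sorted_wrt_append)
      then show False by simp
    qed
    then show ?thesis using 2 "2.IH"(1)[of u2] "2.prems" u by auto
  next
    case 3
    have "u3 = []"
    proof (rule ccontr)
      assume "u3 \<noteq> []"
      then have "hd u3 \<in> set u3" by simp
      then have "?m < hd u3" "hd u3 < ?m"
        using sorted 3(1) set_mono_subseq[OF 3(2)] by (auto simp: sorted_wrt_append)
      then show False by simp
    qed
    then have u_eq: "u = u1 @ [?m]" using u 3 by simp
    show ?thesis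
    proof (cases "u1 = []")
      case True
      then show ?thesis using u_eq by (cases ?B rule: rev_cases) auto
    next
      case False
      note vc = value_consecutive_append1[OF "2.prems"(2)[unfolded u_eq] False]
      obtain b where b: "b \<in> set ?B" "subseq u1 b"
        using "2.IH"(2)[OF u(2) vc(1) False] by blast
      then obtain bs c where B: "?B = bs @ [c]" by (cases ?B rule: rev_cases) auto
      have "c \<noteq> []" using Nil_notin_blocks(4)[of "k + size r" l] B by auto
      \<comment> \<open>In value order the last block \<open>c\<close> ends in
        \<open>?m - 1\<close>. As \<open>b\<close> contains that value too, \<open>b\<close> is the
        block to which \<open>snoc_last\<close> appends \<open>?m\<close>.\<close>
      have conc: "concat ?B = [k + size r..<?m]" by (simp add: ac_simps)
      have "l \<noteq> \<langle>\<rangle>" using b by auto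
      then have "last (concat ?B) = ?m - 1"
        unfolding conc by (subst last_upt) (auto simp: neq_Leaf_iff)
      then have "?m - 1 \<in> set c" using B \<open>c \<noteq> []\<close>
        by (metis concat.simps concat_append append_Nil2 last_appendR last_in_set)
      moreover have "?m - 1 \<in> set b"
        using vc(2) False set_mono_subseq[OF b(2)] last_in_set by fastforce
      moreover have "distinct (concat ?B)" "c \<in> set ?B" by (simp, simp add: B)
      ultimately have "b = c"
        using block_unique[of ?B b c "?m - 1"] b(1) by blast
      then show ?thesis using u_eq b B by (auto intro: list_emb_append_mono)
    qed
  qed
qed simp

lemma vCIS_perm_word: "vCIS (perm_word k t) = set (vcis_blocks k t)"
proof -
  let ?B = "vcis_blocks k t" and ?w = "perm_word k t"
  have block: "b \<noteq> [] \<and> subseq b ?w \<and> value_consecutive b" if b: "b \<in> set ?B" for b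
  proof -
    obtain xs ys where "?B = xs @ b # ys" using split_list[OF b] by blast
    \<comment> \<open>Listed by value the blocks concatenate to an interval, so each block is itself
      an interval of values.\<close>
    then have "sublist b (concat ?B)" by simp
    then have "value_consecutive b" by (auto intro: value_consecutive_sublist_upt)
    moreover have "b \<noteq> []" using b Nil_notin_blocks(4)[of k t] by metis
    ultimately show ?thesis using subseq_vcis_blocks[OF b] by blast
  qed
  have "v = b" if b: "b \<in> set ?B" and v: "subseq v ?w" "value_consecutive v" and bv: "subseq b v"
    for b v
  proof -
    have "v \<noteq> []" using block[OF b] bv by auto
    then obtain c where c: "c \<in> set ?B" "subseq v c"
      using value_consecutive_in_block[OF v] by blast
    have hd: "hd b \<in> set b" using block[OF b] by simp
    then have "hd b \<in> set c"
      using set_mono_subseq[OF bv] set_mono_subseq[OF c(2)] by blast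
    then have "b = c" using block_unique[of ?B b c "hd b"] b c(1) hd by simp
    then show ?thesis using bv c(2) by (simp add: subseq_order.antisym)
  qed
  moreover have "u \<in> set ?B"
    if "u \<noteq> []" "subseq u ?w" "value_consecutive u"
      "\<forall>v. subseq v ?w \<and> value_consecutive v \<and> subseq u v \<longrightarrow> v = u" for u
    using value_consecutive_in_block[OF that(2,3,1)] block that(4) by metis
  ultimately show ?thesis
    using block unfolding vCIS_def by blast
qed

section \<open>Length distributions and their symmetries\<close>

text \<open>These are the block recursions after \<open>map length\<close>. The base
  \<open>k\<close> disappears, so the symmetries can be studied on trees alone.\<close>

fun ird_lengths :: "'a tree \<Rightarrow> nat list" where
  "ird_lengths \<langle>\<rangle> = []"
| "ird_lengths \<langle>l, _, r\<rangle> = inc_last (ird_lengths l) @ ird_lengths r"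

fun drd_lengths :: "'a tree \<Rightarrow> nat list" where
  "drd_lengths \<langle>\<rangle> = []"
| "drd_lengths \<langle>l, _, r\<rangle> = drd_lengths l @ inc_hd (drd_lengths r)"

fun lde_lengths :: "'a tree \<Rightarrow> nat list" where
  "lde_lengths \<langle>\<rangle> = []"
| "lde_lengths \<langle>l, _, r\<rangle> = inc_hd (lde_lengths r) @ lde_lengths l"

fun vcis_lengths :: "'a tree \<Rightarrow> nat list" where
  "vcis_lengths \<langle>\<rangle> = []"
| "vcis_lengths \<langle>l, _, r\<rangle> = vcis_lengths r @ inc_last (vcis_lengths l)"

lemma length_distribution_perm_word:
  "length_distribution (IRD (perm_word k t)) = mset (ird_lengths t)"
  "length_distribution (DRD (perm_word k t)) = mset (drd_lengths t)"
  "length_distribution (LDE (perm_word k t)) = mset (lde_lengths t)"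
  "length_distribution (vCIS (perm_word k t)) = mset (vcis_lengths t)"
proof -
  have lengths: "map length (ird_blocks k t) = ird_lengths t"
    "map length (drd_blocks k t) = drd_lengths t"
    "map length (lde_blocks k t) = lde_lengths t"
    "map length (vcis_blocks k t) = vcis_lengths t"
    by (induction t arbitrary: k) auto
  \<comment> \<open>Unlike for runs, the concatenated paths only rearrange the word, so distinctness
    is transferred through multisets.\<close>
  have lde: "distinct (concat (lde_blocks k t))"
    using mset_eq_imp_distinct_iff[OF mset_concat_lde_blocks[of k t]] by simp
  show "length_distribution (IRD (perm_word k t)) = mset (ird_lengths t)"
    unfolding IRD_perm_word lengths(1)[symmetric] by (rule length_distribution_set) simp_all
  show "length_distribution (DRD (perm_word k t)) = mset (drd_lengths t)"
    unfolding DRD_perm_word lengths(2)[symmetric] by (rule length_distribution_set) simp_all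
  show "length_distribution (LDE (perm_word k t)) = mset (lde_lengths t)"
    unfolding LDE_perm_word lengths(3)[symmetric]
    by (rule length_distribution_set) (simp_all only: lde Nil_notin_blocks not_False_eq_True)
  show "length_distribution (vCIS (perm_word k t)) = mset (vcis_lengths t)"
    unfolding vCIS_perm_word lengths(4)[symmetric] by (rule length_distribution_set) simp_all
qed

section \<open>Mirroring trees\<close>

lemma inc_last_rev: "inc_last (rev as) = rev (inc_hd as)"
  and inc_hd_rev: "inc_hd (rev as) = rev (inc_last as)"
  by (simp_all add: inc_last_def)

text \<open>The two recursions differ only by swapping the subtrees and reading the lists
  backwards.\<close>

lemma drd_lengths_mirror: "drd_lengths (mirror t) = rev (ird_lengths t)"
  by (induction t) (simp_all add: inc_hd_rev)

lemma vcis_lengths_mirror: "vcis_lengths (mirror t) = rev (lde_lengths t)"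
  by (induction t) (simp_all add: inc_last_rev)

lemma ird_lengths_mirror: "ird_lengths (mirror t) = rev (drd_lengths t)"
  using drd_lengths_mirror[of "mirror t"] by simp

lemma lde_lengths_mirror: "lde_lengths (mirror t) = rev (vcis_lengths t)"
  by (induction t) (simp_all add: inc_hd_rev)

section \<open>Reversing chains of right children\<close>

text \<open>The second argument accumulates the part of the chain that is already reversed.\<close>
fun rev_chain :: "'a tree \<Rightarrow> 'a tree \<Rightarrow> 'a tree" where
  "rev_chain \<langle>\<rangle> a = a"
| "rev_chain \<langle>l, x, r\<rangle> a = rev_chain r \<langle>rev_chain l \<langle>\<rangle>, x, a\<rangle>"

text \<open>This is the accumulator law of list reversal; for \<open>a = \<langle>\<rangle>\<close>
  it says that chain reversal is an involution.\<close>

lemma rev_chain_rev_chain: "rev_chain (rev_chain t a) \<langle>\<rangle> = rev_chain a t"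
  by (induction t arbitrary: a) simp_all

lemma size_rev_chain [simp]: "size (rev_chain t a) = size t + size a"
  by (induction t arbitrary: a) simp_all

lemma rev_chain_eq_Leaf [simp]: "rev_chain t a = \<langle>\<rangle> \<longleftrightarrow> t = \<langle>\<rangle> \<and> a = \<langle>\<rangle>"
  by (metis add_is_0 eq_size_0 size_rev_chain)

lemma lengths_eq_Nil [simp]:
  "ird_lengths t = [] \<longleftrightarrow> t = \<langle>\<rangle>" "lde_lengths t = [] \<longleftrightarrow> t = \<langle>\<rangle>"
  "vcis_lengths t = [] \<longleftrightarrow> t = \<langle>\<rangle>"
  by (cases t; simp)+

lemma inc_hd_eq: "inc_hd as = Suc (if as = [] then 0 else hd as) # tl as"
  by (cases as) auto

lemma mset_lde_lengths:
  "t \<noteq> \<langle>\<rangle> \<Longrightarrow>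
   mset (lde_lengths t) = add_mset (hd (lde_lengths t)) (mset (tl (lde_lengths t)))"
  by (metis lengths_eq_Nil(2) list.collapse mset.simps(2))

text \<open>The head is the length of the right chain through the root, taken as 0 for the empty
  tree. Moving the chain of \<open>t\<close> onto that of \<open>a\<close> adds these lengths; all
  other lengths come from left subtrees, whose order along the chain changes, hence the
  multisets.\<close>

lemma lde_lengths_rev_chain_acc:
  "(if rev_chain t a = \<langle>\<rangle> then 0 else hd (lde_lengths (rev_chain t a))) =
     (if t = \<langle>\<rangle> then 0 else hd (lde_lengths t)) + (if a = \<langle>\<rangle> then 0 else hd (lde_lengths a)) \<and>
   mset (tl (lde_lengths (rev_chain t a))) =
     mset (tl (lde_lengths t)) + mset (tl (lde_lengths a))"
proof (induction t arbitrary: a)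
  case (Node l x r)
  have "mset (lde_lengths (rev_chain l \<langle>\<rangle>)) = mset (lde_lengths l)"
    using Node.IH(1)[of "\<langle>\<rangle>"]
    by (cases "l = \<langle>\<rangle>") (simp_all add: mset_lde_lengths)
  then show ?case
    using Node.IH(2)[of "\<langle>rev_chain l \<langle>\<rangle>, x, a\<rangle>"]
    by (simp add: inc_hd_eq split: if_splits)
qed simp

lemma lde_lengths_rev_chain: "mset (lde_lengths (rev_chain t \<langle>\<rangle>)) = mset (lde_lengths t)"
  using lde_lengths_rev_chain_acc[of t "\<langle>\<rangle>"]
  by (cases "t = \<langle>\<rangle>") (simp_all add: mset_lde_lengths)

lemma mset_inc_last_cong:
  assumes "mset as = mset bs" "as \<noteq> [] \<Longrightarrow> last as = last bs"
  shows "mset (inc_last as) = mset (inc_last bs)"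
  using assms by (cases as rule: rev_cases; cases bs rule: rev_cases) auto

lemma last_inc_last_cong:
  assumes "as = [] \<longleftrightarrow> bs = []" "as \<noteq> [] \<Longrightarrow> last as = last bs"
  shows "last (inc_last as) = last (inc_last bs)"
  using assms by (cases as rule: rev_cases; cases bs rule: rev_cases) auto

text \<open>Both statistics collect \<open>inc_last\<close> of the lists of the left subtrees along
  the chain; the final entry comes from the first subtree for v-CIS and from the last one for IRD.
  Reversal matches these ends: the root of \<open>t\<close> ends up right before \<open>a\<close>,
  or at the end of the chain if \<open>a\<close> is empty. The final entries are tracked because a
  parent increments them.\<close>

lemma ird_lengths_rev_chain_acc:
  "mset (ird_lengths (rev_chain t a)) = mset (vcis_lengths t) + mset (ird_lengths a) \<and>
   (a \<noteq> \<langle>\<rangle> \<longrightarrow> last (ird_lengths (rev_chain t a)) = last (ird_lengths a)) \<and>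
   (a = \<langle>\<rangle> \<longrightarrow> t \<noteq> \<langle>\<rangle> \<longrightarrow> last (ird_lengths (rev_chain t a)) = last (vcis_lengths t))"
proof (induction t arbitrary: a)
  case (Node l x r)
  \<comment> \<open>Equal multisets alone would not survive \<open>inc_last\<close>; the induction
    hypothesis with empty accumulator also supplies equal last entries.\<close>
  have "mset (inc_last (ird_lengths (rev_chain l \<langle>\<rangle>))) = mset (inc_last (vcis_lengths l))"
    "last (inc_last (ird_lengths (rev_chain l \<langle>\<rangle>))) = last (inc_last (vcis_lengths l))"
    using Node.IH(1)[of "\<langle>\<rangle>"] by (auto intro!: mset_inc_last_cong last_inc_last_cong)
  then show ?case
    using Node.IH(2)[of "\<langle>rev_chain l \<langle>\<rangle>, x, a\<rangle>"]
    by (cases "a = \<langle>\<rangle>") (simp_all add: last_append ac_simps)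
qed simp

lemma ird_lengths_rev_chain: "mset (ird_lengths (rev_chain t \<langle>\<rangle>)) = mset (vcis_lengths t)"
  using ird_lengths_rev_chain_acc[of t "\<langle>\<rangle>"] by simp

section \<open>Transfer of the counts to trees\<close>

lemma card_eq_of_involution:
  assumes "\<And>x. f (f x) = x" "\<And>x. P x \<longleftrightarrow> Q (f x)"
  shows "card {x. P x} = card {x. Q x}"
proof (rule bij_betw_same_card)
  show "bij_betw f {x. P x} {x. Q x}"
    using assms by (intro bij_betw_byWitness[where f' = f]) auto
qed

lemma card_S132_eq:
  "card {w \<in> S132 n. P w} = card {t::unit tree. size t = n \<and> P (perm_word 1 t)}"
proof -
  have "bij_betw (perm_word 1) {t::unit tree. size t = n \<and> P (perm_word 1 t)} {w \<in> S132 n. P w}"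
  proof (rule bij_betw_subset[OF bij_betw_perm_word[of n]])
    show "perm_word 1 ` {t::unit tree. size t = n \<and> P (perm_word 1 t)} = {w \<in> S132 n. P w}"
      unfolding bij_betw_imp_surj_on[OF bij_betw_perm_word[of n], symmetric] by blast
  qed blast
  then show ?thesis by (rule bij_betw_same_card[symmetric])
qed

theorem theorem5p1:
  fixes n :: nat and lam mu :: "nat multiset"
  assumes "n \<ge> 1" and "integer_partition n lam" and "integer_partition n mu"
  shows
    "card {w \<in> S132 n. length_distribution (IRD w) = lam \<and> length_distribution (LDE w) = mu} =
     card {w \<in> S132 n. length_distribution (IRD w) = mu \<and> length_distribution (LDE w) = lam} \<and>
     card {w \<in> S132 n. length_distribution (IRD w) = mu \<and> length_distribution (LDE w) = lam} =
     card {w \<in> S132 n. length_distribution (vCIS w) = lam \<and> length_distribution (DRD w) = mu} \<and>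
     card {w \<in> S132 n. length_distribution (vCIS w) = lam \<and> length_distribution (DRD w) = mu} =
     card {w \<in> S132 n. length_distribution (vCIS w) = mu \<and> length_distribution (DRD w) = lam}"
proof -
  define T where "T f g a b = card {t::unit tree. size t = n \<and> mset (f t) = a \<and> mset (g t) = b}"
    for f g :: "unit tree \<Rightarrow> nat list" and a b
  \<comment> \<open>Chain reversal preserves LDE lengths and turns v-CIS into IRD; being an
    involution, it also turns IRD into v-CIS.\<close>
  have ird_lde: "T ird_lengths lde_lengths a b = T vcis_lengths lde_lengths a b" for a b
    unfolding T_def
    by (rule card_eq_of_involution[where f = "\<lambda>t. rev_chain t \<langle>\<rangle>"])
      (simp_all add: rev_chain_rev_chain lde_lengths_rev_chain flip: ird_lengths_rev_chain)
  have sym: "T vcis_lengths lde_lengths a b = T vcis_lengths lde_lengths b a" for a b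
    unfolding T_def
    by (rule card_eq_of_involution[where f = mirror])
      (auto simp: vcis_lengths_mirror lde_lengths_mirror)
  \<comment> \<open>Mirroring sends v-CIS to LDE and DRD to IRD, so the two prescribed partitions
    change places.\<close>
  have vcis_drd: "T vcis_lengths drd_lengths a b = T ird_lengths lde_lengths b a" for a b
    unfolding T_def
    by (rule card_eq_of_involution[where f = mirror])
      (auto simp: lde_lengths_mirror vcis_lengths_mirror ird_lengths_mirror)
  have "card {w \<in> S132 n. length_distribution (IRD w) = a \<and> length_distribution (LDE w) = b} =
      T vcis_lengths lde_lengths a b" for a b
    unfolding ird_lde[symmetric] unfolding card_S132_eq length_distribution_perm_word T_def ..
  moreover have "card {w \<in> S132 n. length_distribution (vCIS w) = a \<and> length_distribution (DRD w) = b} =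
      T vcis_lengths lde_lengths a b" for a b
    \<comment> \<open>The partitions are exchanged twice, once by \<open>sym\<close> and once by
      \<open>vcis_drd\<close>, so the order \<open>a b\<close> is restored.\<close>
    unfolding sym[of a b] unfolding ird_lde[symmetric] unfolding vcis_drd[symmetric]
    unfolding card_S132_eq length_distribution_perm_word T_def ..
  ultimately show ?thesis
    using sym[of lam mu] by simp
qed

end
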